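(* Let $m\in\mathbb N$, $\Sigma=\{\alpha_1,\alpha_2,\dots\}$ an infinite countable alphabet, $\upsilon\notin\Sigma$ a variable, $\vec k=(k_n)_{n\in\mathbb N}\subseteq\mathbb N$ an increasing sequence and $r,s\in\mathbb N$. If $W^m(\Sigma,\vec k;\upsilon)=A_1\cup\dots\cup A_r$ and $W^m(\Sigma,\vec k)=C_1\cup\dots\cup C_s$, then there exist $\vec w\in W^\infty(\Sigma,\vec k;\upsilon)$ and $1\le i_0\le r$, $1\le j_0\le s$ such that $RV^m(\vec w)\subseteq A_{i_0}$ and $R^m(\vec w)\subseteq C_{j_0}$.
   Context: $\mathbb N=\{1,2,\dots\}$. $W(\Sigma,\vec k)$: words $w_1\dots w_l$ ($l\in\mathbb N$) with $w_i\in\{\alpha_1,\dots,\alpha_{k_i}\}$; $W(\Sigma,\vec k;\upsilon)$: words $w_1\dots w_l$ with $w_i\in\{\upsilon,\alpha_1,\dots,\alpha_{k_i}\}$ and some $w_i=\upsilon$. For $w=w_1\dots w_l$, $u=u_1\dots u_r$, $w<u$ iff $l<r$ and $u_1=\dots=u_l=\alpha_1$; then $w\star u=w_1\dots w_lu_{l+1}\dots u_r$. $T_0(w)=w$; for $p\in\mathbb N$, $T_p(w)$ replaces each $w_i=\upsilon$ by $\alpha_p$ if $k_i\ge p$ and by $\alpha_{k_i}$ otherwise. $W^\infty(\Sigma,\vec k;\upsilon)$: sequences $(w_n)$ in $W(\Sigma,\vec k;\upsilon)$ with $w_n<w_{n+1}$. $W^m(\Sigma,\vec k;\upsilon)$ (resp.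 $W^m(\Sigma,\vec k)$): $m$-tuples $(u_1,\dots,u_m)$ with $u_1<\dots<u_m$ in $W(\Sigma,\vec k;\upsilon)$ (resp. $W(\Sigma,\vec k)$). For $\vec w=(w_n)\in W^\infty(\Sigma,\vec k;\upsilon)$: $RV^m(\vec w)$ is the set of $(u_1,\dots,u_m)\in W^m(\Sigma,\vec k;\upsilon)$ for which there are integers $0=\lambda_1<\lambda_2<\dots<\lambda_{m+1}$ with $u_i=T_{p_{\lambda_i+1}}(w_{\lambda_i+1})\star\cdots\star T_{p_{\lambda_{i+1}}}(w_{\lambda_{i+1}})$ for each $1\le i\le m$, where $p_j$ are integers with $0\le p_j\le k_j$ and $0\in\{p_{\lambda_i+1},\dots,p_{\lambda_{i+1}}\}$; $R^m(\vec w)$ is the set of $(u_1,\dots,u_m)\in W^m(\Sigma,\vec k)$ of the same form with $1\le p_j\le k_j$ for all $j$. *)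

theory Defs
  imports Main
begin

text \<open>
  The alphabet is enumerated by \<open>a\<close>, so that the letter \<open>\<alpha>\<^sub>i\<close> is \<open>a i\<close> for \<open>i \<ge> 1\<close>, and \<open>v\<close> is the
  variable. The dominating sequence \<open>k\<close>, the sequences of words \<open>w\<close>, and the indices \<open>l\<close> and \<open>p\<close>
  are all indexed from 1; their values at 0 are never used. Words and tuples are lists, which are
  indexed from 0: position \<open>i\<close> of a list is its \<open>(i + 1)\<close>-st entry, and is governed by \<open>k (i + 1)\<close>.
\<close>

definition words :: "(nat \<Rightarrow> 'a) \<Rightarrow> (nat \<Rightarrow> nat) \<Rightarrow> 'a list set" where
  "words a k = {w. w \<noteq> [] \<and> (\<forall>i<length w. w ! i \<in> a ` {1..k (i + 1)})}"

definition var_words :: "(nat \<Rightarrow> 'a) \<Rightarrow> 'a \<Rightarrow> (nat \<Rightarrow> nat) \<Rightarrow> 'a list set" where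
  "var_words a v k =
     {w. w \<noteq> [] \<and> (\<forall>i<length w. w ! i \<in> insert v (a ` {1..k (i + 1)})) \<and> v \<in> set w}"

definition before :: "(nat \<Rightarrow> 'a) \<Rightarrow> 'a list \<Rightarrow> 'a list \<Rightarrow> bool" where
  "before a w u \<longleftrightarrow> length w < length u \<and> (\<forall>i<length w. u ! i = a 1)"

text \<open>Only meaningful if \<open>w\<close> comes before \<open>u\<close>, or if \<open>u\<close> is empty, in which case it yields \<open>w\<close>.\<close>

definition star :: "'a list \<Rightarrow> 'a list \<Rightarrow> 'a list" where
  "star w u = w @ drop (length w) u"

definition T :: "(nat \<Rightarrow> 'a) \<Rightarrow> 'a \<Rightarrow> (nat \<Rightarrow> nat) \<Rightarrow> nat \<Rightarrow> 'a list \<Rightarrow> 'a list" where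
  "T a v k p w =
     (if p = 0 then w
      else map (\<lambda>i. if w ! i = v then (if k (i + 1) \<ge> p then a p else a (k (i + 1))) else w ! i)
             [0..<length w])"

definition word_tuples :: "(nat \<Rightarrow> 'a) \<Rightarrow> (nat \<Rightarrow> nat) \<Rightarrow> nat \<Rightarrow> 'a list list set" where
  "word_tuples a k m = {us. length us = m \<and> set us \<subseteq> words a k \<and> successively (before a) us}"

definition var_word_tuples :: "(nat \<Rightarrow> 'a) \<Rightarrow> 'a \<Rightarrow> (nat \<Rightarrow> nat) \<Rightarrow> nat \<Rightarrow> 'a list list set" where
  "var_word_tuples a v k m =
     {us. length us = m \<and> set us \<subseteq> var_words a v k \<and> successively (before a) us}"

definition var_word_seqs :: "(nat \<Rightarrow> 'a) \<Rightarrow> 'a \<Rightarrow> (nat \<Rightarrow> nat) \<Rightarrow> (nat \<Rightarrow> 'a list) set" where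
  "var_word_seqs a v k = {w. \<forall>n\<ge>1. w n \<in> var_words a v k \<and> before a (w n) (w (n + 1))}"

text \<open>
  The word \<open>T\<^bsub>p (x + 1)\<^esub> (w (x + 1)) \<star> \<dots> \<star> T\<^bsub>p y\<^esub> (w y)\<close>, for \<open>x < y\<close>. The start value \<open>[]\<close> of the fold is
  harmless because \<open>star u [] = u\<close>.
\<close>

definition block ::
    "(nat \<Rightarrow> 'a) \<Rightarrow> 'a \<Rightarrow> (nat \<Rightarrow> nat) \<Rightarrow> (nat \<Rightarrow> 'a list) \<Rightarrow> (nat \<Rightarrow> nat) \<Rightarrow> nat \<Rightarrow> nat \<Rightarrow> 'a list" where
  "block a v k w p x y = foldr star (map (\<lambda>j. T a v k (p j) (w j)) [x + 1..<y + 1]) []"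

definition RV ::
    "(nat \<Rightarrow> 'a) \<Rightarrow> 'a \<Rightarrow> (nat \<Rightarrow> nat) \<Rightarrow> nat \<Rightarrow> (nat \<Rightarrow> 'a list) \<Rightarrow> 'a list list set" where
  "RV a v k m w =
     {us \<in> var_word_tuples a v k m. \<exists>l p.
        l 1 = 0 \<and> strict_mono_on {1..m + 1} l \<and>
        (\<forall>j\<in>{1..l (m + 1)}. p j \<le> k j) \<and>
        (\<forall>i\<in>{1..m}. us ! (i - 1) = block a v k w p (l i) (l (i + 1)) \<and>
                     0 \<in> p ` {l i + 1..l (i + 1)})}"

definition R ::
    "(nat \<Rightarrow> 'a) \<Rightarrow> 'a \<Rightarrow> (nat \<Rightarrow> nat) \<Rightarrow> nat \<Rightarrow> (nat \<Rightarrow> 'a list) \<Rightarrow> 'a list list set" where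
  "R a v k m w =
     {us \<in> word_tuples a k m. \<exists>l p.
        l 1 = 0 \<and> strict_mono_on {1..m + 1} l \<and>
        (\<forall>j\<in>{1..l (m + 1)}. 1 \<le> p j \<and> p j \<le> k j) \<and>
        (\<forall>i\<in>{1..m}. us ! (i - 1) = block a v k w p (l i) (l (i + 1)))}"

end

theory Submission
  imports Defs "HOL-Analysis.Function_Topology"
begin

text \<open>
  Since \<open>k\<close> is nondecreasing, the dominated words form a semigroup under concatenation, and a sequence
  of words \<open>w\<^sub>1 < w\<^sub>2 < \<dots>\<close> amounts to a sequence of words that are concatenated. In the semigroup of
  ultrafilters, let \<open>p\<close> be a minimal idempotent on the constant words, and let \<open>q\<close> be an idempotent on
  the variable words with \<open>pq = qp = q\<close> that contains, for each \<open>j\<close>, the set of words whose variables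
  occur from position \<open>j\<close> on. Substituting an available letter in \<open>q\<close> gives an idempotent on the
  constant words below \<open>p\<close>, hence \<open>p\<close> itself. Iterated limits along \<open>q\<close> attach a colour to each partial
  tuple, and the equations between \<open>p\<close>, \<open>q\<close> and the substitutions allow a greedy choice of words, under
  which all partial tuples keep the limit colour.
\<close>

section \<open>Idempotents in compact right topological semigroups\<close>

text \<open>Distinct functions differ at some coordinate, and preimages under that coordinate
  separate them. Compact sets of predicates on sets are therefore closed, which the minimality
  arguments rely on.\<close>

instance "fun" :: (type, t2_space) t2_space
proof
  fix f g :: "'a \<Rightarrow> 'b"
  assume "f \<noteq> g"
  then obtain i where "f i \<noteq> g i" by auto
  then obtain U V where UV: "open U" "open V" "f i \<in> U" "g i \<in> V" "U \<inter> V = {}"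
    using hausdorff by metis
  have "open ((\<lambda>h::'a \<Rightarrow> 'b. h i) -` U)" "open ((\<lambda>h::'a \<Rightarrow> 'b. h i) -` V)"
    using UV by (auto intro!: open_vimage)
  then show "\<exists>U V. open U \<and> open V \<and> f \<in> U \<and> g \<in> V \<and> U \<inter> V = {}"
    using UV by (intro exI[of _ "(\<lambda>h. h i) -` U"] exI[of _ "(\<lambda>h. h i) -` V"]) auto
qed

lemma compact_UNIV_bool_fun: "compact (UNIV :: ('a \<Rightarrow> bool) set)"
proof -
  have "compactin (product_topology (\<lambda>_. euclidean) (UNIV :: 'a set)) (\<Pi>\<^sub>E i\<in>UNIV. (UNIV :: bool set))"
    unfolding compactin_PiE by (auto intro: finite_imp_compact)
  then show ?thesis
    by (simp add: euclidean_product_topology)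
qed

text \<open>Finite intersection property: finitely many members of a chain have a smallest one, and
  it is nonempty.\<close>

lemma compact_chain_Inter_nonempty:
  fixes \<C> :: "'a::t2_space set set"
  assumes "\<C> \<noteq> {}" and "\<And>C. C \<in> \<C> \<Longrightarrow> compact C \<and> C \<noteq> {}"
    and "\<And>C D. C \<in> \<C> \<Longrightarrow> D \<in> \<C> \<Longrightarrow> C \<subseteq> D \<or> D \<subseteq> C"
  shows "\<Inter>\<C> \<noteq> {}"
proof -
  obtain U where U: "U \<in> \<C>" using assms(1) by auto
  have *: "\<exists>D\<in>\<C>. D \<subseteq> U \<inter> \<Inter>B" if "finite B" "B \<subseteq> \<C>" for B
    using that
  proof (induction B)
    case empty
    then show ?case using U by auto
  next
    case (insert C B)
    then obtain D where "D \<in> \<C>" "D \<subseteq> U \<inter> \<Inter>B" by auto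
    then show ?case
      using assms(3)[of C D] insert.prems
      by (intro bexI[of _ "if C \<subseteq> D then C else D"]) auto
  qed
  have "U \<inter> \<Inter>\<C> \<noteq> {}"
  proof (rule compact_fip[THEN iffD1, rule_format])
    show "compact U" using assms(2) U by auto
    show "closed C" if "C \<in> \<C>" for C
      using assms(2)[OF that] by (simp add: compact_imp_closed)
    show "U \<inter> \<Inter>B \<noteq> {}" if "B \<subseteq> \<C>" "finite B" for B
      using *[OF that(2,1)] assms(2) by blast
  qed
  then show ?thesis by auto
qed

text \<open>Zorn's lemma for reverse inclusion. It serves twice: with \<open>P\<close> expressing a
  subsemigroup, and with \<open>P\<close> expressing a left ideal.\<close>

lemma minimal_compact_exists:
  fixes C :: "'a::t2_space set"
  assumes C: "compact C" "C \<noteq> {}" "P C"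
    and Inter: "\<And>\<C>. \<C> \<noteq> {} \<Longrightarrow> \<forall>D\<in>\<C>. P D \<Longrightarrow> P (\<Inter>\<C>)"
  obtains M where "compact M" "M \<noteq> {}" "P M" "M \<subseteq> C"
    and "\<And>D. compact D \<Longrightarrow> D \<noteq> {} \<Longrightarrow> P D \<Longrightarrow> D \<subseteq> M \<Longrightarrow> D = M"
proof -
  define \<A> where "\<A> = {D. compact D \<and> D \<noteq> {} \<and> P D \<and> D \<subseteq> C}"
  \<comment> \<open>\<open>subset_Zorn_nonempty\<close> produces maximal sets, so it is applied to
    the complements; the union of a chain of complements is the complement of an
    intersection.\<close>
  have "\<exists>M\<in>uminus ` \<A>. \<forall>X\<in>uminus ` \<A>. M \<subseteq> X \<longrightarrow> X = M"
  proof (rule subset_Zorn_nonempty)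
    show "uminus ` \<A> \<noteq> {}" using C by (auto simp: \<A>_def)
    fix \<C> assume ne: "\<C> \<noteq> {}" and chain: "subset.chain (uminus ` \<A>) \<C>"
    define \<D> where "\<D> = uminus ` \<C>"
    have \<D>: "\<D> \<noteq> {}" "\<D> \<subseteq> \<A>" using ne chain by (auto simp: \<D>_def subset.chain_def)
    have "\<Inter>\<D> \<noteq> {}"
    proof (rule compact_chain_Inter_nonempty[OF \<D>(1)])
      show "compact D \<and> D \<noteq> {}" if "D \<in> \<D>" for D
        using that \<D>(2) by (auto simp: \<A>_def)
      show "D \<subseteq> E \<or> E \<subseteq> D" if "D \<in> \<D>" "E \<in> \<D>" for D E
        using that chain unfolding \<D>_def subset_chain_def by blast
    qed
    moreover have "compact (\<Inter>\<D>)"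
    proof -
      obtain D where D: "D \<in> \<D>" using \<D>(1) by auto
      have "closed (\<Inter>\<D>)"
        using \<D>(2) by (intro closed_Inter) (auto simp: \<A>_def compact_imp_closed)
      then have "compact (D \<inter> \<Inter>\<D>)"
        using D \<D>(2) by (intro compact_Int_closed) (auto simp: \<A>_def)
      moreover have "D \<inter> \<Inter>\<D> = \<Inter>\<D>" using D by auto
      ultimately show ?thesis by simp
    qed
    moreover have "P (\<Inter>\<D>)"
      using \<D> by (intro Inter) (auto simp: \<A>_def)
    moreover have "\<Inter>\<D> \<subseteq> C"
      using \<D> by (auto simp: \<A>_def)
    ultimately have "\<Inter>\<D> \<in> \<A>" by (simp add: \<A>_def)
    moreover have "\<Union>\<C> = - \<Inter>\<D>" by (auto simp: \<D>_def)
    ultimately show "\<Union>\<C> \<in> uminus ` \<A>" by blast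
  qed
  then obtain M where M: "M \<in> \<A>" and *: "\<And>X. X \<in> \<A> \<Longrightarrow> - M \<subseteq> - X \<Longrightarrow> - X = - M"
    by (auto simp del: Compl_subset_Compl_iff Compl_eq_Compl_iff)
  show thesis
  proof (rule that)
    show "D = M" if "compact D" "D \<noteq> {}" "P D" "D \<subseteq> M" for D
      using *[of D] that M by (auto simp: \<A>_def)
  qed (use M in \<open>auto simp: \<A>_def\<close>)
qed

text \<open>Continuity is required in the left factor only, which is what \<open>conv\<close>
  provides. Compactness is assumed of subsets, so the operation may live on a larger type than the
  ultrafilters.\<close>

locale compact_right_topological_semigroup =
  fixes f :: "'a::t2_space \<Rightarrow> 'a \<Rightarrow> 'a" (infixl \<open>\<odot>\<close> 70)
  assumes assoc: "x \<odot> y \<odot> z = x \<odot> (y \<odot> z)"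
    and continuous: "continuous_on UNIV (\<lambda>x. x \<odot> y)"
begin

lemma compact_translate: "compact C \<Longrightarrow> compact ((\<lambda>x. x \<odot> y) ` C)"
  using continuous continuous_on_subset compact_continuous_image by (metis subset_UNIV)

definition subsemigroup :: "'a set \<Rightarrow> bool" where
  "subsemigroup C \<longleftrightarrow> (\<forall>x\<in>C. \<forall>y\<in>C. x \<odot> y \<in> C)"

text \<open>Ellis-Numakura. In a minimal compact subsemigroup \<open>M\<close>,
  \<open>Mx = M\<close> makes \<open>yx = x\<close> solvable; the solutions form a compact
  subsemigroup, hence all of \<open>M\<close>, so \<open>x\<close> itself is a solution.\<close>

lemma idempotent_exists:
  assumes "compact C" "C \<noteq> {}" "subsemigroup C"
  obtains e where "e \<in> C" "e \<odot> e = e"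
proof -
  obtain M where M: "compact M" "M \<noteq> {}" "subsemigroup M" "M \<subseteq> C"
    and min: "\<And>D. compact D \<Longrightarrow> D \<noteq> {} \<Longrightarrow> subsemigroup D \<Longrightarrow> D \<subseteq> M \<Longrightarrow> D = M"
    by (rule minimal_compact_exists[of C subsemigroup])
       (use assms in \<open>auto simp: subsemigroup_def\<close>)
  obtain x where x: "x \<in> M" using M by auto
  have "(\<lambda>y. y \<odot> x) ` M = M"
  proof (rule min)
    show "subsemigroup ((\<lambda>y. y \<odot> x) ` M)"
      unfolding subsemigroup_def
    proof (clarify)
      fix y z assume "y \<in> M" "z \<in> M"
      then have "y \<odot> x \<odot> z \<in> M" using M(3) x by (auto simp: subsemigroup_def)
      then show "y \<odot> x \<odot> (z \<odot> x) \<in> (\<lambda>y. y \<odot> x) ` M" by (auto simp flip: assoc)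
    qed
  qed (use M x in \<open>auto intro: compact_translate simp: subsemigroup_def\<close>)
  then obtain y where y: "y \<in> M" "y \<odot> x = x" using x by force
  have "{y \<in> M. y \<odot> x = x} = M"
  proof (rule min)
    have "closed ((\<lambda>y. y \<odot> x) -` {x})"
      by (rule closed_vimage[OF _ continuous]) simp
    then have "compact (M \<inter> (\<lambda>y. y \<odot> x) -` {x})"
      using M(1) by (rule compact_Int_closed[rotated])
    then show "compact {y \<in> M. y \<odot> x = x}"
      by (simp add: vimage_def Int_def)
  qed (use M y in \<open>auto simp: subsemigroup_def assoc\<close>)
  then have "x \<odot> x = x" using x by auto
  with x M(4) show thesis using that by auto
qed

text \<open>Take an idempotent \<open>p\<close> in a minimal compact left ideal \<open>L\<close>. If
  \<open>e\<close> is an idempotent below \<open>p\<close>, then \<open>e = ep\<close> lies in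
  \<open>L\<close>, so \<open>Ce = L\<close> by minimality; thus \<open>p = xe\<close> for some
  \<open>x\<close>, and \<open>p = pe = e\<close>.\<close>

lemma minimal_idempotent_exists:
  assumes C: "compact C" "C \<noteq> {}" "subsemigroup C"
  obtains p where "p \<in> C" "p \<odot> p = p"
    and "\<And>e. e \<in> C \<Longrightarrow> e \<odot> e = e \<Longrightarrow> p \<odot> e = e \<Longrightarrow> e \<odot> p = e \<Longrightarrow> e = p"
proof -
  define P where "P L \<longleftrightarrow> L \<subseteq> C \<and> (\<forall>x\<in>C. \<forall>y\<in>L. x \<odot> y \<in> L)" for L
  obtain L where L: "compact L" "L \<noteq> {}" "P L"
    and min: "\<And>D. compact D \<Longrightarrow> D \<noteq> {} \<Longrightarrow> P D \<Longrightarrow> D \<subseteq> L \<Longrightarrow> D = L"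
    by (rule minimal_compact_exists[of C P])
       (use C in \<open>simp_all add: subsemigroup_def P_def, blast\<close>)
  obtain p where p: "p \<in> L" "p \<odot> p = p"
    by (rule idempotent_exists[of L]) (use L in \<open>auto simp: P_def subsemigroup_def\<close>)
  have "e = p" if e: "e \<in> C" "e \<odot> e = e" "p \<odot> e = e" "e \<odot> p = e" for e
  proof -
    have "e \<in> L" using L(3) p e by (metis P_def)
    have "(\<lambda>x. x \<odot> e) ` C = L"
    proof (rule min)
      have "x \<odot> (y \<odot> e) \<in> (\<lambda>x. x \<odot> e) ` C" if "x \<in> C" "y \<in> C" for x y
        using that C(3) by (auto simp: subsemigroup_def simp flip: assoc)
      then show "P ((\<lambda>x. x \<odot> e) ` C)"
        using C(3) e by (auto simp: P_def subsemigroup_def)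
      show "(\<lambda>x. x \<odot> e) ` C \<subseteq> L" using L(3) \<open>e \<in> L\<close> by (auto simp: P_def)
    qed (use C in \<open>auto intro: compact_translate\<close>)
    then obtain x where "p = x \<odot> e" using p by auto
    then have "p \<odot> e = p" using e(2) by (simp add: assoc)
    then show "e = p" using e by simp
  qed
  then show thesis using that[of p] p L(3) by (auto simp: P_def)
qed

end

section \<open>The semigroup of ultrafilters on words\<close>

text \<open>An ultrafilter is represented by its characteristic function, so that the ultrafilters
  form a subset of the product space \<open>'b set \<Rightarrow> bool\<close>, which is compact by
  Tychonoff.\<close>

definition ultra :: "('b set \<Rightarrow> bool) \<Rightarrow> bool" where
  "ultra p \<longleftrightarrow> p UNIV \<and> (\<forall>A B. A \<subseteq> B \<longrightarrow> p A \<longrightarrow> p B) \<and> (\<forall>A B. p A \<longrightarrow> p B \<longrightarrow> p (A \<inter> B)) \<and>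
     (\<forall>A. p (- A) \<longleftrightarrow> \<not> p A)"

lemma ultra_mono: "ultra p \<Longrightarrow> p A \<Longrightarrow> A \<subseteq> B \<Longrightarrow> p B"
  by (simp add: ultra_def)

lemma ultra_Int: "ultra p \<Longrightarrow> p A \<Longrightarrow> p B \<Longrightarrow> p (A \<inter> B)"
  by (simp add: ultra_def)

lemma ultra_Compl: "ultra p \<Longrightarrow> p (- A) \<longleftrightarrow> \<not> p A"
  by (simp add: ultra_def)

lemma ultra_UNIV: "ultra p \<Longrightarrow> p UNIV"
  by (simp add: ultra_def)

lemma ultra_Collect_conj: "ultra p \<Longrightarrow> p {x. P x \<and> Q x} \<longleftrightarrow> p {x. P x} \<and> p {x. Q x}"
  using ultra_Int[of p "{x. P x}" "{x. Q x}"]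
  by (auto simp: Int_def intro: ultra_mono)

lemma ultra_nonempty: "ultra p \<Longrightarrow> p A \<Longrightarrow> A \<noteq> {}"
  using ultra_Compl[of p UNIV] ultra_UNIV[of p] by auto

lemma ultra_cong: "ultra p \<Longrightarrow> p D \<Longrightarrow> (\<And>x. x \<in> D \<Longrightarrow> x \<in> A \<longleftrightarrow> x \<in> B) \<Longrightarrow> p A \<longleftrightarrow> p B"
  using ultra_mono[where p = p and A = "D \<inter> A" and B = B] ultra_mono[where p = p and A = "D \<inter> B" and B = A]
    ultra_Int[of p D A] ultra_Int[of p D B] by (meson Int_iff subsetI)

lemma ultra_finite_Ball:
  assumes "ultra p" "finite I" "\<And>i. i \<in> I \<Longrightarrow> p {x. P i x}"
  shows "p {x. \<forall>i\<in>I. P i x}"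
  using assms(2,3)
  by (induction I) (auto simp: ultra_Collect_conj[OF assms(1)] ultra_UNIV[OF assms(1)])

lemma ultra_finite_range:
  assumes "ultra p" "finite (range g)"
  obtains d where "d \<in> range g" "p {x. g x = d}"
proof (rule ccontr)
  assume "\<not> thesis"
  then have "\<not> p {x. g x = d}" if "d \<in> range g" for d
    using that \<open>\<And>d. d \<in> range g \<Longrightarrow> p {x. g x = d} \<Longrightarrow> thesis\<close> by blast
  then have "p {x. g x \<noteq> d}" if "d \<in> range g" for d
    using that ultra_Compl[OF assms(1), of "{x. g x = d}"] by (simp add: Compl_eq)
  then have "p {x. \<forall>d\<in>range g. g x \<noteq> d}"
    by (rule ultra_finite_Ball[OF assms])
  then show False using ultra_nonempty[OF assms(1)] by blast
qed

lemma ultra_principal: "ultra (\<lambda>A. x \<in> A)"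
  by (auto simp: ultra_def)

lemma closed_coord [simp]: "closed {p :: 'b \<Rightarrow> bool. p A}"
  and open_coord [simp]: "open {p :: 'b \<Rightarrow> bool. p A}"
proof -
  have "{p. p A} = (\<lambda>p. p A) -` {True}" by auto
  then show "closed {p :: 'b \<Rightarrow> bool. p A}" "open {p :: 'b \<Rightarrow> bool. p A}"
    by (simp_all add: closed_vimage open_vimage open_discrete)
qed

text \<open>Each instance of the axioms involves finitely many coordinates with discrete values, so
  it is a closed condition.\<close>

lemma closed_ultra: "closed {p. ultra p}"
  unfolding ultra_def iff_conv_conj_imp
  by (intro closed_Collect_conj closed_Collect_all closed_Collect_imp closed_Collect_neg
      open_Collect_neg closed_coord open_coord closed_Collect_const open_Collect_const)

lemma compact_ultra: "closed {p. P p} \<Longrightarrow> compact {p. ultra p \<and> P p}"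
  using compact_Int_closed[OF compact_UNIV_bool_fun closed_Collect_conj[OF closed_ultra]] by simp

text \<open>The usual extension of concatenation to ultrafilters. With \<open>p\<close> as the outer
  quantifier, each coordinate of \<open>conv p q\<close> is a coordinate of \<open>p\<close>, which
  gives continuity in \<open>p\<close>.\<close>

definition conv :: "('a list set \<Rightarrow> bool) \<Rightarrow> ('a list set \<Rightarrow> bool) \<Rightarrow> 'a list set \<Rightarrow> bool" where
  "conv p q A \<longleftrightarrow> p {x. q {y. x @ y \<in> A}}"

interpretation conv: compact_right_topological_semigroup conv
proof
  show "conv (conv p q) r = conv p (conv q r)" for p q r :: "'a list set \<Rightarrow> bool"
    by (simp add: conv_def fun_eq_iff)
  show "continuous_on UNIV (\<lambda>p. conv p q)" for q :: "'a list set \<Rightarrow> bool"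
    unfolding conv_def
    by (intro continuous_on_coordinatewise_then_product continuous_on_product_coordinates)
qed

lemma ultra_conv: "ultra p \<Longrightarrow> ultra q \<Longrightarrow> ultra (conv p q)"
  unfolding ultra_def[of "conv p q"] conv_def
proof (intro conjI allI impI)
  assume p: "ultra p" and q: "ultra q"
  show "p {x. q {y. x @ y \<in> UNIV}}"
    by (simp add: ultra_UNIV p q)
  show "p {x. q {y. x @ y \<in> B}}" if "A \<subseteq> B" "p {x. q {y. x @ y \<in> A}}" for A B
    by (rule ultra_mono[OF p that(2)]) (use that(1) in \<open>auto elim!: ultra_mono[OF q]\<close>)
  show "p {x. q {y. x @ y \<in> A \<inter> B}}" if "p {x. q {y. x @ y \<in> A}}" "p {x. q {y. x @ y \<in> B}}" for A B
    using that by (simp add: ultra_Collect_conj[OF p] ultra_Collect_conj[OF q])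
  show "p {x. q {y. x @ y \<in> - A}} \<longleftrightarrow> \<not> p {x. q {y. x @ y \<in> A}}" for A
    using ultra_Compl[OF q, of "{y. _ @ y \<in> A}"] ultra_Compl[OF p, of "{x. q {y. x @ y \<in> A}}"]
    by (simp add: Compl_eq)
qed

lemma conv_mem:
  assumes "ultra p" "ultra q" "p A" "q B" "\<And>x y. x \<in> A \<Longrightarrow> y \<in> B \<Longrightarrow> x @ y \<in> D"
  shows "conv p q D"
  unfolding conv_def
  by (rule ultra_mono[OF assms(1,3)]) (auto intro: ultra_mono[OF assms(2,4)] assms(5))

definition push :: "('b \<Rightarrow> 'c) \<Rightarrow> ('b set \<Rightarrow> bool) \<Rightarrow> 'c set \<Rightarrow> bool" where
  "push h p A \<longleftrightarrow> p (h -` A)"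

lemma ultra_push: "ultra p \<Longrightarrow> ultra (push h p)"
  unfolding ultra_def[of "push h p"] push_def vimage_Compl vimage_Int
  by (auto simp: ultra_Compl ultra_UNIV intro: ultra_Int elim: ultra_mono[OF _ _ vimage_mono])

lemma push_conv:
  assumes "\<And>x y. h (x @ y) = h x @ h y"
  shows "push h (conv p q) = conv (push h p) (push h q)"
  by (simp add: push_def conv_def fun_eq_iff vimage_def assms)

section \<open>Coded words\<close>

text \<open>Words are coded by lists of numbers: \<open>0\<close> is the variable, \<open>c \<ge> 1\<close> the \<open>c\<close>-th letter.\<close>

definition subst :: "nat \<Rightarrow> nat list \<Rightarrow> nat list" where
  "subst c = map (\<lambda>b. if b = 0 then c else b)"

lemma subst_append [simp]: "subst c (x @ y) = subst c x @ subst c y"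
  by (simp add: subst_def)

lemma subst_0 [simp]: "subst 0 x = x"
  by (auto simp: subst_def intro: map_idI)

lemma length_subst [simp]: "length (subst c x) = length x"
  by (simp add: subst_def)

definition const_codes :: "(nat \<Rightarrow> nat) \<Rightarrow> nat list set" where
  "const_codes \<kappa> = {x. \<forall>i<length x. 1 \<le> x ! i \<and> x ! i \<le> \<kappa> i}"

text \<open>Since the variable occurs only from position \<open>j\<close> on, every letter up to \<open>\<kappa> j\<close> can be
  substituted for it without leaving the dominated words.\<close>

definition var_codes :: "(nat \<Rightarrow> nat) \<Rightarrow> nat \<Rightarrow> nat list set" where
  "var_codes \<kappa> j = {x. (\<forall>i<length x. x ! i \<le> \<kappa> i) \<and> 0 \<in> set x \<and> (\<forall>i<length x. x ! i = 0 \<longrightarrow> j \<le> i)}"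

lemma subst_const_codes: "x \<in> const_codes \<kappa> \<Longrightarrow> subst c x = x"
  unfolding subst_def
  by (rule map_idI) (auto simp: const_codes_def in_set_conv_nth)

lemma subst_var_codes:
  assumes "mono \<kappa>" "x \<in> var_codes \<kappa> j" "1 \<le> c" "c \<le> \<kappa> j"
  shows "subst c x \<in> const_codes \<kappa>"
  using assms by (fastforce simp: subst_def const_codes_def var_codes_def dest: monoD)

text \<open>Concatenation moves the letters of \<open>y\<close> to later positions, where a monotone
  \<open>\<kappa>\<close> permits at least as many letters.\<close>

lemma const_codes_append:
  assumes "mono \<kappa>" "x \<in> const_codes \<kappa>" "y \<in> const_codes \<kappa>"
  shows "x @ y \<in> const_codes \<kappa>"
proof -
  have "1 \<le> (x @ y) ! i \<and> (x @ y) ! i \<le> \<kappa> i" if "i < length (x @ y)" for i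
  proof (cases "i < length x")
    case False
    then have "i - length x < length y" using that by auto
    moreover have "\<kappa> (i - length x) \<le> \<kappa> i" using assms(1) by (simp add: monoD)
    ultimately show ?thesis
      using False assms(3) by (auto simp: const_codes_def nth_append intro: order_trans)
  qed (use assms(2) in \<open>simp add: const_codes_def nth_append\<close>)
  then show ?thesis by (simp add: const_codes_def)
qed

lemma var_codes_append:
  assumes "mono \<kappa>" "x \<in> const_codes \<kappa> \<union> var_codes \<kappa> j" "y \<in> const_codes \<kappa> \<union> var_codes \<kappa> j"
    "x \<in> var_codes \<kappa> j \<or> y \<in> var_codes \<kappa> j"
  shows "x @ y \<in> var_codes \<kappa> j"
proof -
  have le: "\<kappa> (i - length x) \<le> \<kappa> i" for i
    using assms(1) by (simp add: monoD)
  have x: "x ! i \<le> \<kappa> i \<and> (x ! i = 0 \<longrightarrow> j \<le> i)" if "i < length x" for i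
    using that assms(2) by (auto simp: const_codes_def var_codes_def)
  have y: "y ! i \<le> \<kappa> i \<and> (y ! i = 0 \<longrightarrow> j \<le> i)" if "i < length y" for i
    using that assms(3) by (auto simp: const_codes_def var_codes_def)
  have "(x @ y) ! i \<le> \<kappa> i \<and> ((x @ y) ! i = 0 \<longrightarrow> j \<le> i)" if "i < length (x @ y)" for i
  proof (cases "i < length x")
    case False
    then have "i - length x < length y" using that by auto
    from y[OF this] False le[of i] show ?thesis
      by (auto simp: nth_append intro: order_trans[OF _ diff_le_self])
  qed (use x in \<open>simp add: nth_append\<close>)
  moreover have "0 \<in> set (x @ y)"
    using assms(4) by (auto simp: var_codes_def)
  ultimately show ?thesis by (simp add: var_codes_def)
qed

text \<open>From an idempotent \<open>e\<close> in \<open>Lp\<close> one gets \<open>ep = e\<close>,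
  and \<open>q = pe\<close> absorbs \<open>p\<close> on both sides. Substitution is a homomorphism
  that fixes \<open>p\<close>, so the image of \<open>q\<close> is an idempotent below the minimal
  \<open>p\<close>.\<close>

lemma compatible_idempotents:
  assumes \<kappa>: "mono \<kappa>" "\<And>n. 1 \<le> \<kappa> n"
  obtains p q where "ultra p" "ultra q" "conv p p = p" "conv q q = q" "conv p q = q" "conv q p = q"
    and "\<And>j. q (var_codes \<kappa> j)" and "\<And>c j. 1 \<le> c \<Longrightarrow> c \<le> \<kappa> j \<Longrightarrow> push (subst c) q = p"
proof -
  define C where "C = {p. ultra p \<and> p (const_codes \<kappa>)}"
  have C: "compact C" unfolding C_def by (rule compact_ultra) simp
  have "C \<noteq> {}"
    using ultra_principal[of "[]"] by (auto simp: C_def const_codes_def)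
  moreover have "conv.subsemigroup C"
    by (auto simp: conv.subsemigroup_def C_def ultra_conv intro: conv_mem const_codes_append[OF \<kappa>(1)])
  ultimately obtain p where p: "p \<in> C" "conv p p = p"
    and min: "\<And>e. e \<in> C \<Longrightarrow> conv e e = e \<Longrightarrow> conv p e = e \<Longrightarrow> conv e p = e \<Longrightarrow> e = p"
    using conv.minimal_idempotent_exists[OF C] by metis
  define V where "V j = {q. ultra q \<and> q (var_codes \<kappa> j)}" for j
  \<comment> \<open>Membership in every \<open>V j\<close> is what later allows any letter bounded
    by some \<open>\<kappa> j\<close> to be substituted in \<open>q\<close>. The sets
    \<open>V j\<close> decrease with \<open>j\<close>, so compactness keeps the intersection
    nonempty.\<close>
  define L where "L = \<Inter>(range V)"
  have compact_V: "compact (V j)" for j unfolding V_def by (rule compact_ultra) simp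
  have "L \<noteq> {}" unfolding L_def
  proof (rule compact_chain_Inter_nonempty)
    show "range V \<noteq> {}" by simp
  next
    fix D assume "D \<in> range V"
    then obtain j where D: "D = V j" by auto
    have "replicate j 1 @ [0] \<in> var_codes \<kappa> j"
      using \<kappa>(2) by (auto simp: var_codes_def nth_append)
    then have "(\<lambda>A. replicate j 1 @ [0] \<in> A) \<in> V j"
      by (simp add: V_def ultra_principal)
    then show "compact D \<and> D \<noteq> {}" using compact_V D by auto
  next
    fix D E assume "D \<in> range V" "E \<in> range V"
    then obtain i j where DE: "D = V i" "E = V j" by auto
    have "V j \<subseteq> V i" if "i \<le> j" for i j
      using that by (fastforce simp: V_def var_codes_def elim: ultra_mono)
    then show "D \<subseteq> E \<or> E \<subseteq> D"
      using DE by (metis nat_le_linear)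
  qed
  have "compact L"
    using compact_Int_closed[OF compact_UNIV_bool_fun closed_INT[of UNIV V]] compact_V
    by (simp add: L_def compact_imp_closed)
  have L_iff: "q \<in> L \<longleftrightarrow> ultra q \<and> (\<forall>j. q (var_codes \<kappa> j))" for q
    by (auto simp: L_def V_def)
  have up: "ultra p" "p (const_codes \<kappa>)" using p by (auto simp: C_def)
  have Lp: "conv x p \<in> L" if "x \<in> L" for x
    using that up by (auto simp: L_iff ultra_conv intro!: conv_mem[where p = x] var_codes_append[OF \<kappa>(1)])
  have pL: "conv p x \<in> L" if "x \<in> L" for x
    using that up by (auto simp: L_iff ultra_conv intro!: conv_mem[where p = p] var_codes_append[OF \<kappa>(1)])
  have LL: "conv x y \<in> L" if "x \<in> L" "y \<in> L" for x y
    using that by (auto simp: L_iff ultra_conv intro!: conv_mem[where p = x] var_codes_append[OF \<kappa>(1)])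
  have "conv.subsemigroup ((\<lambda>x. conv x p) ` L)"
    unfolding conv.subsemigroup_def
  proof clarify
    fix x y assume "x \<in> L" "y \<in> L"
    then show "conv (conv x p) (conv y p) \<in> (\<lambda>x. conv x p) ` L"
      using LL[OF Lp] by (auto simp flip: conv.assoc)
  qed
  then obtain e where e: "e \<in> (\<lambda>x. conv x p) ` L" "conv e e = e"
    using conv.idempotent_exists[OF conv.compact_translate[OF \<open>compact L\<close>]] \<open>L \<noteq> {}\<close>
    by (metis image_is_empty)
  define q where "q = conv p e"
  have ep: "conv e p = e" using e(1) p(2) by (auto simp: conv.assoc)
  have qL: "q \<in> L" using e(1) Lp pL by (auto simp: q_def)
  have q: "conv q q = q" "conv p q = q" "conv q p = q"
    using ep e(2) p(2) by (metis conv.assoc q_def)+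
  have "push (subst c) q = p" if c: "1 \<le> c" "c \<le> \<kappa> j" for c j
  proof (rule min)
    \<comment> \<open>\<open>p\<close> lives on constant words, where substitution does
      nothing.\<close>
    have pp: "push (subst c) p = p"
    proof
      show "push (subst c) p A = p A" for A
        unfolding push_def
        by (rule ultra_cong[OF up]) (simp add: subst_const_codes)
    qed
    have "push (subst c) q (const_codes \<kappa>)"
      unfolding push_def
      by (rule ultra_mono[of q "var_codes \<kappa> j"])
         (use qL c \<kappa>(1) in \<open>auto simp: L_iff intro: subst_var_codes[unfolded One_nat_def]\<close>)
    then show "push (subst c) q \<in> C"
      using qL by (simp add: C_def L_iff ultra_push)
    show "conv (push (subst c) q) (push (subst c) q) = push (subst c) q"
      by (simp flip: push_conv add: q)
    show "conv p (push (subst c) q) = push (subst c) q"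
      by (metis pp q(2) push_conv subst_append)
    show "conv (push (subst c) q) p = push (subst c) q"
      by (metis pp q(3) push_conv subst_append)
  qed
  then show thesis
    using that[of p q] p q up qL by (auto simp: L_iff)
qed

section \<open>Monochromatic sequences\<close>

text \<open>The colour of \<open>ys\<close> after \<open>i\<close> further words are appended in an
  iterated limit along \<open>q\<close>, with the first appended word as the outermost
  limit.\<close>

primrec lim_colour :: "(nat list set \<Rightarrow> bool) \<Rightarrow> (nat list list \<Rightarrow> 'c) \<Rightarrow> nat \<Rightarrow> nat list list \<Rightarrow> 'c" where
  "lim_colour q c 0 ys = c ys"
| "lim_colour q c (Suc i) ys = (SOME d. q {y. lim_colour q c i (ys @ [y]) = d})"

text \<open>The two claims depend on each other: finitely many values at level \<open>i\<close> make
  the limit exist, and a limit colour is attained since members of \<open>q\<close> are nonempty, so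
  no new values arise at the next level.\<close>

lemma lim_colour_Suc:
  assumes "ultra q" "finite (range c)"
  shows "q {y. lim_colour q c i (ys @ [y]) = lim_colour q c (Suc i) ys}"
    and "range (lim_colour q c i) \<subseteq> range c"
proof -
  have *: "q {y. lim_colour q c i (ys @ [y]) = lim_colour q c (Suc i) ys}"
    if "range (lim_colour q c i) \<subseteq> range c" for i ys
  proof -
    have "finite (range (\<lambda>y. lim_colour q c i (ys @ [y])))"
      by (rule finite_subset[OF _ assms(2)]) (use that in blast)
    then obtain d where "q {y. lim_colour q c i (ys @ [y]) = d}"
      by (rule ultra_finite_range[OF assms(1)])
    then show ?thesis by (simp) (rule someI)
  qed
  show range: "range (lim_colour q c i) \<subseteq> range c"
  proof (induction i)
    case (Suc i)
    have "lim_colour q c (Suc i) ys \<in> range c" for ys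
    proof -
      obtain y where "lim_colour q c i (ys @ [y]) = lim_colour q c (Suc i) ys"
        using ultra_nonempty[OF assms(1) *[OF Suc]] by blast
      then show ?thesis using Suc by (metis range_subsetD)
    qed
    then show ?case by blast
  qed auto
  show "q {y. lim_colour q c i (ys @ [y]) = lim_colour q c (Suc i) ys}"
    by (rule *[OF range])
qed

text \<open>The coded counterpart of \<open>block\<close>, without padding and on a half-open
  interval counted from 0.\<close>

definition cat :: "(nat \<Rightarrow> nat list) \<Rightarrow> (nat \<Rightarrow> nat) \<Rightarrow> nat \<Rightarrow> nat \<Rightarrow> nat list" where
  "cat X a i j = concat (map (\<lambda>t. subst (a t) (X t)) [i..<j])"

lemma cat_self [simp]: "cat X a i i = []"
  by (simp add: cat_def)

lemma cat_Suc: "i \<le> j \<Longrightarrow> cat X a i (Suc j) = cat X a i j @ subst (a j) (X j)"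
  by (simp add: cat_def)

lemma cat_append_left: "i < j \<Longrightarrow> cat X a i j = subst (a i) (X i) @ cat X a (Suc i) j"
  by (simp add: cat_def upt_conv_Cons)

lemma zero_in_cat:
  assumes "0 \<in> a ` {i..<j}" "\<And>t. 0 \<in> set (X t)"
  shows "0 \<in> set (cat X a i j)"
  using assms by (force simp: cat_def)

section \<open>Greedy choice of the words along the idempotents\<close>

locale tuple_colouring =
  fixes \<kappa> :: "nat \<Rightarrow> nat" and p q :: "nat list set \<Rightarrow> bool" and c :: "nat list list \<Rightarrow> 'c" and m :: nat
  assumes \<kappa>_pos: "1 \<le> \<kappa> n"
    and p: "ultra p" and q: "ultra q"
    and pp: "conv p p = p" and qq: "conv q q = q" and pq: "conv p q = q" and qp: "conv q p = q"
    and q_var_codes: "q (var_codes \<kappa> 0)"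
    and push_q: "1 \<le> a \<Longrightarrow> a \<le> \<kappa> n \<Longrightarrow> push (subst a) q = p"
    and finite_colours: "finite (range c)"
begin

text \<open>For a full tuple, no limit remains and this says that \<open>c ys\<close> is the limit
  colour.\<close>

definition good :: "nat list list \<Rightarrow> bool" where
  "good ys \<longleftrightarrow> length ys \<le> m \<and> lim_colour q c (m - length ys) ys = lim_colour q c m []"

lemma good_Nil: "good []"
  by (simp add: good_def)

lemma good_step:
  assumes "good ys" "length ys < m"
  shows "q {y. good (ys @ [y])}"
proof -
  define i where "i = m - Suc (length ys)"
  have i: "m - length ys = Suc i" using assms(2) by (simp add: i_def)
  have "q {y. lim_colour q c i (ys @ [y]) = lim_colour q c (Suc i) ys}"
    by (rule lim_colour_Suc(1)[OF q finite_colours])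
  then show ?thesis
    by (rule ultra_mono[OF q]) (use assms i in \<open>auto simp: good_def i_def simp del: lim_colour.simps\<close>)
qed

text \<open>A pair \<open>(ys, u)\<close> stands for a tuple under construction: the words in \<open>ys\<close> are finished, while
  \<open>u\<close> may still be continued.\<close>

definition extendible :: "nat list list \<times> nat list \<Rightarrow> bool" where
  "extendible = (\<lambda>(ys, u). length ys < m \<and> q {y. good (ys @ [u @ y])} \<and>
     (0 \<in> set u \<longrightarrow> good (ys @ [u]) \<and> p {y. good (ys @ [u @ y])}))"

text \<open>Before the next word is read, the current word may be closed if it has a variable and a
  further word is still due. The last word of a tuple is never closed here; its goodness is read off
  \<open>extendible\<close>.\<close>

definition branch :: "(nat list list \<times> nat list) set \<Rightarrow> (nat list list \<times> nat list) set" where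
  "branch S = S \<union> (\<lambda>(ys, u). (ys @ [u], [])) ` {(ys, u) \<in> S. 0 \<in> set u \<and> Suc (length ys) < m}"

text \<open>All admissible substitutions into the new word are recorded at once; there are only
  finitely many because \<open>a \<le> \<kappa> n\<close>.\<close>

definition extend ::
    "nat \<Rightarrow> nat list \<Rightarrow> (nat list list \<times> nat list) set \<Rightarrow> (nat list list \<times> nat list) set" where
  "extend n x S = (\<lambda>((ys, u), a). (ys, u @ subst a x)) ` (branch S \<times> {..\<kappa> n})"

lemma finite_branch: "finite S \<Longrightarrow> finite (branch S)"
  unfolding branch_def by (intro finite_UnI finite_imageI) (auto elim: rev_finite_subset)

lemma finite_extend: "finite S \<Longrightarrow> finite (extend n x S)"
  unfolding extend_def by (intro finite_imageI finite_cartesian_product finite_branch) auto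

lemma extendible_branch:
  assumes "\<And>s. s \<in> S \<Longrightarrow> extendible s" "s \<in> branch S"
  shows "extendible s"
proof (cases "s \<in> S")
  case False
  then obtain ys u where s: "s = (ys @ [u], [])" "(ys, u) \<in> S" "0 \<in> set u" "Suc (length ys) < m"
    using assms(2) by (auto simp: branch_def)
  then have "good (ys @ [u])" using assms(1)[OF s(2)] by (simp add: extendible_def)
  from good_step[OF this] s show ?thesis by (simp add: extendible_def)
qed (rule assms(1))

text \<open>Let \<open>B\<close> consist of the continuations of \<open>u\<close> that keep the
  tuple good. For \<open>a = 0\<close>, \<open>q B\<close> is expanded by \<open>q = qq\<close> and
  \<open>q = qp\<close>. For \<open>a \<ge> 1\<close>, the substituted word is distributed by
  \<open>p\<close>, so \<open>q = pq\<close> applies, and also \<open>p = pp\<close> if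
  \<open>u\<close> already has a variable.\<close>

lemma extendible_subst:
  assumes "extendible (ys, u)" "a \<le> \<kappa> n"
  shows "q {x. extendible (ys, u @ subst a x)}"
proof -
  define B where "B = {y. good (ys @ [u @ y])}"
  have len: "length ys < m" and qB: "q B" and pB: "0 \<in> set u \<Longrightarrow> p B"
    using assms(1) by (auto simp: extendible_def B_def)
  have ext: "extendible (ys, u @ z) \<longleftrightarrow>
      q {y. z @ y \<in> B} \<and> (0 \<in> set u \<or> 0 \<in> set z \<longrightarrow> z \<in> B \<and> p {y. z @ y \<in> B})" for z
    using len by (simp add: extendible_def B_def)
  show ?thesis
  proof (cases "a = 0")
    case True
    have "q {x. q {y. x @ y \<in> B}}" using qB qq by (metis conv_def)
    moreover have "q {x. p {y. x @ y \<in> B}}" using qB qp by (metis conv_def)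
    moreover have "q {x. x \<in> B}" using qB by simp
    ultimately have "q {x. q {y. x @ y \<in> B} \<and> x \<in> B \<and> p {y. x @ y \<in> B}}"
      by (simp add: ultra_Collect_conj[OF q])
    then show ?thesis
      by (rule ultra_mono[OF q]) (auto simp: ext True)
  next
    case False
    have push: "q {x. P (subst a x)} \<longleftrightarrow> p {z. P z}" for P
      using fun_cong[OF push_q[of a n], of "Collect P"] False assms(2) by (simp add: push_def vimage_def)
    have "q {x. q {y. subst a x @ y \<in> B}}"
      unfolding push[of "\<lambda>z. q {y. z @ y \<in> B}"] using qB pq by (metis conv_def)
    moreover have "q {x. subst a x \<in> B}" "q {x. p {y. subst a x @ y \<in> B}}" if "0 \<in> set u"
      unfolding push[of "\<lambda>z. z \<in> B"] push[of "\<lambda>z. p {y. z @ y \<in> B}"]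
      using pB[OF that] pp by (simp, metis conv_def)
    moreover have "0 \<notin> set (subst a x)" for x
      using False by (auto simp: subst_def)
    ultimately show ?thesis
      by (cases "0 \<in> set u") (simp_all add: ext ultra_Collect_conj[OF q])
  qed
qed

text \<open>Finitely many conditions, each holding on a set in \<open>q\<close>, hold together for
  some variable word.\<close>

lemma extend_exists:
  assumes "finite S" "\<And>s. s \<in> S \<Longrightarrow> extendible s"
  obtains x where "x \<in> var_codes \<kappa> 0" "\<And>s. s \<in> extend n x S \<Longrightarrow> extendible s"
proof -
  have "q {x. \<forall>s\<in>branch S \<times> {..\<kappa> n}. extendible (fst (fst s), snd (fst s) @ subst (snd s) x)}"
  proof (rule ultra_finite_Ball[OF q])
    show "q {x. extendible (fst (fst s), snd (fst s) @ subst (snd s) x)}"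
      if "s \<in> branch S \<times> {..\<kappa> n}" for s
      using that extendible_branch[OF assms(2)] extendible_subst by auto
  qed (use finite_branch[OF assms(1)] in simp)
  from ultra_nonempty[OF q ultra_Int[OF q q_var_codes this]] obtain x where
    "x \<in> var_codes \<kappa> 0" "\<forall>s\<in>branch S \<times> {..\<kappa> n}. extendible (fst (fst s), snd (fst s) @ subst (snd s) x)"
    by blast
  then show thesis
    by (intro that[of x]) (fastforce simp: extend_def)+
qed

lemma sequence_exists:
  assumes "1 \<le> m"
  obtains X S where "S 0 = {([], [])}" "\<And>n. S (Suc n) = extend n (X n) (S n)"
    "\<And>n. X n \<in> var_codes \<kappa> 0" "\<And>n s. s \<in> S n \<Longrightarrow> extendible s"
proof -
  have init: "extendible ([], [])"
    using assms good_step[OF good_Nil] by (simp add: extendible_def)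
  have "\<exists>S. \<forall>n. ((finite (S n) \<and> (\<forall>s\<in>S n. extendible s)) \<and> (n = 0 \<longrightarrow> S n = {([], [])})) \<and>
      (\<exists>x. x \<in> var_codes \<kappa> 0 \<and> S (Suc n) = extend n x (S n))"
  proof (rule dependent_nat_choice, goal_cases)
    case 1
    show ?case using init by (intro exI[of _ "{([], [])}"]) simp
  next
    case (2 S n)
    then obtain x where "x \<in> var_codes \<kappa> 0" "\<And>s. s \<in> extend n x S \<Longrightarrow> extendible s"
      using extend_exists[of S n] by blast
    moreover have "finite (extend n x S)"
      using 2 by (simp add: finite_extend)
    ultimately show ?case by (intro exI[of _ "extend n x S"]) auto
  qed
  then obtain S where S: "\<forall>n. ((finite (S n) \<and> (\<forall>s\<in>S n. extendible s)) \<and> (n = 0 \<longrightarrow> S n = {([], [])})) \<and>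
      (\<exists>x. x \<in> var_codes \<kappa> 0 \<and> S (Suc n) = extend n x (S n))" ..
  have "\<forall>n. \<exists>x. x \<in> var_codes \<kappa> 0 \<and> S (Suc n) = extend n x (S n)"
    using S by simp
  from choice[OF this] obtain X where "\<forall>n. X n \<in> var_codes \<kappa> 0 \<and> S (Suc n) = extend n (X n) (S n)" ..
  then show thesis by (intro that[of S X]) (use S in simp_all)
qed

text \<open>Every admissible choice of \<open>l\<close> and \<open>a\<close> is one path through the
  sets \<open>S n\<close>, so its final tuple is good.\<close>

lemma monochromatic_sequence:
  assumes "1 \<le> m"
  obtains X where "\<And>n. X n \<in> var_codes \<kappa> 0"
    and "\<And>l a. l 0 = 0 \<Longrightarrow> (\<And>i. i < m \<Longrightarrow> l i < l (Suc i)) \<Longrightarrow> (\<And>t. t < l m \<Longrightarrow> a t \<le> \<kappa> t) \<Longrightarrow>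
      (\<And>i. i < m \<Longrightarrow> 0 \<in> a ` {l i..<l (Suc i)}) \<Longrightarrow>
      c (map (\<lambda>i. cat X a (l i) (l (Suc i))) [0..<m]) = lim_colour q c m []"
proof (rule sequence_exists[OF assms])
  fix X S
  assume S0: "S 0 = {([], [])}" and S_Suc: "\<And>n. S (Suc n) = extend n (X n) (S n)"
    and X: "\<And>n. X n \<in> var_codes \<kappa> 0" and ext: "\<And>n s. s \<in> S n \<Longrightarrow> extendible s"
  show thesis
  proof (rule that[OF X])
    fix l a
    assume l0: "l 0 = 0" and l: "\<And>i. i < m \<Longrightarrow> l i < l (Suc i)"
      and a: "\<And>t. t < l m \<Longrightarrow> a t \<le> \<kappa> t"
      and zero: "\<And>i. i < m \<Longrightarrow> 0 \<in> a ` {l i..<l (Suc i)}"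
    define u where "u i = cat X a (l i) (l (Suc i))" for i
    define ys where "ys i = map u [0..<i]" for i
    have l_le: "l i \<le> l m" if "i \<le> m" for i
      using that
    proof (induction rule: inc_induct)
      case (step i)
      then show ?case using l[of i] by simp
    qed simp
    have u0: "0 \<in> set (u i)" if "i < m" for i
      unfolding u_def by (rule zero_in_cat[OF zero[OF that]]) (use X in \<open>simp add: var_codes_def\<close>)
    \<comment> \<open>While word \<open>i\<close> is being built. The claim starts after
      \<open>l i\<close> because at \<open>l i\<close> the pair with the empty word is only known to
      lie in \<open>branch (S (l i))\<close>.\<close>
    have run: "(ys i, cat X a (l i) n) \<in> S n"
      if "(ys i, []) \<in> branch (S (l i))" "i < m" "l i < n" "n \<le> l (Suc i)" for i n
      using that(3,4)
    proof (induction n)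
      case (Suc n)
      have "(ys i, cat X a (l i) n) \<in> branch (S n)"
      proof (cases "n = l i")
        case True
        then show ?thesis using that(1) by simp
      next
        case False
        then show ?thesis using Suc by (simp add: branch_def)
      qed
      moreover have "a n \<le> \<kappa> n"
        using a[of n] Suc.prems l_le[of "Suc i"] \<open>i < m\<close> by simp
      ultimately show ?case
        using Suc.prems by (force simp: S_Suc extend_def cat_Suc)
    qed simp
    \<comment> \<open>Word \<open>i\<close> has reached its end and contains a variable, so
      \<open>branch\<close> may close it and open the next one.\<close>
    have start: "(ys i, []) \<in> branch (S (l i))" if "i < m" for i
      using that
    proof (induction i)
      case 0
      then show ?case by (simp add: ys_def l0 S0 branch_def)
    next
      case (Suc i)
      then have "(ys i, u i) \<in> S (l (Suc i))"
        using run[of i "l (Suc i)"] l[of i] by (simp add: u_def)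
      then show ?case
        using Suc.prems u0[of i] by (force simp: branch_def ys_def)
    qed
    have "(ys (m - 1), u (m - 1)) \<in> S (l m)"
      using run[of "m - 1" "l m"] start[of "m - 1"] l[of "m - 1"] assms by (simp add: u_def)
    then have "good (ys (m - 1) @ [u (m - 1)])"
      using ext u0[of "m - 1"] assms by (fastforce simp: extendible_def)
    moreover have "ys (m - 1) @ [u (m - 1)] = ys m"
      using assms by (cases m) (auto simp: ys_def)
    ultimately have "good (ys m)" by simp
    then have "c (ys m) = lim_colour q c m []" by (simp add: good_def ys_def)
    then show "c (map (\<lambda>i. cat X a (l i) (l (Suc i))) [0..<m]) = lim_colour q c m []"
      by (simp add: ys_def u_def[abs_def])
  qed
qed

end

lemma monochromatic_var_code_sequence:
  fixes \<kappa> :: "nat \<Rightarrow> nat" and c :: "nat list list \<Rightarrow> 'c"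
  assumes "mono \<kappa>" "\<And>n. 1 \<le> \<kappa> n" "finite (range c)" "1 \<le> m"
  obtains X d where "d \<in> range c" and "\<And>n. X n \<in> var_codes \<kappa> 0"
    and "\<And>l a. l 0 = 0 \<Longrightarrow> (\<And>i. i < m \<Longrightarrow> l i < l (Suc i)) \<Longrightarrow> (\<And>t. t < l m \<Longrightarrow> a t \<le> \<kappa> t) \<Longrightarrow>
      (\<And>i. i < m \<Longrightarrow> 0 \<in> a ` {l i..<l (Suc i)}) \<Longrightarrow>
      c (map (\<lambda>i. cat X a (l i) (l (Suc i))) [0..<m]) = d"
proof (rule compatible_idempotents[OF assms(1,2)])
  fix p q
  assume PQ: "ultra p" "ultra q" "conv p p = p" "conv q q = q" "conv p q = q" "conv q p = q"
    "\<And>j. q (var_codes \<kappa> j)" "\<And>c j. 1 \<le> c \<Longrightarrow> c \<le> \<kappa> j \<Longrightarrow> push (subst c) q = p"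
  interpret tuple_colouring \<kappa> p q c m
    by unfold_locales (use PQ assms(2,3) in blast)+
  have range: "lim_colour q c m [] \<in> range c"
    using lim_colour_Suc(2)[OF PQ(2) assms(3)] by blast
  show thesis
  proof (rule monochromatic_sequence[OF assms(4)], goal_cases)
    case (1 X)
    show thesis by (rule that[OF range 1])
  qed
qed

section \<open>Reduction of constant words to variable words\<close>

lemma subst_nonzero: "0 \<notin> set x \<Longrightarrow> subst c x = x"
  unfolding subst_def by (rule map_idI) auto

lemma subst_subst: "c \<noteq> 0 \<Longrightarrow> subst b (subst c x) = subst c x"
  by (rule subst_nonzero) (auto simp: subst_def)

text \<open>Every second word is used with the letter \<open>1\<close> only. A constant word over the pairs is then the
  instance at \<open>1\<close> of a variable word over the original sequence, which has the variable at every
  second word; this reduces the colouring of constant words to that of variable words.\<close>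

definition pair_up :: "(nat \<Rightarrow> nat list) \<Rightarrow> nat \<Rightarrow> nat list" where
  "pair_up X n = X (2 * n) @ subst 1 (X (Suc (2 * n)))"

lemma cat_pair_up_var:
  "x \<le> y \<Longrightarrow> cat (pair_up X) a x y = cat X (\<lambda>t. if even t then a (t div 2) else 1) (2 * x) (2 * y)"
proof (induction rule: dec_induct)
  case (step y)
  then show ?case by (simp add: cat_Suc pair_up_def subst_subst)
qed simp

text \<open>At even positions the substituted letter is nonzero and \<open>subst 1\<close> leaves it
  alone; at odd positions the variable turns into the letter 1, as in
  \<open>pair_up\<close>.\<close>

lemma cat_pair_up_const:
  assumes "x \<le> y" "\<And>t. x \<le> t \<Longrightarrow> t < y \<Longrightarrow> 1 \<le> a t"
  shows "cat (pair_up X) a x y = subst 1 (cat X (\<lambda>t. if even t then a (t div 2) else 0) (2 * x) (2 * y))"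
  using assms
proof (induction rule: dec_induct)
  case base
  then show ?case by (simp add: subst_def)
next
  case (step y)
  then have "a y \<noteq> 0" by force
  with step show ?case by (simp add: cat_Suc pair_up_def subst_subst)
qed

lemma pair_up_var_codes:
  assumes "mono \<kappa>" "\<And>n. 1 \<le> \<kappa> n" "\<And>n. X n \<in> var_codes \<kappa> 0"
  shows "pair_up X n \<in> var_codes \<kappa> 0"
  unfolding pair_up_def
  using assms(3)[of "2 * n"] subst_var_codes[OF assms(1,3), of 1 "Suc (2 * n)"] assms(2)[of 0]
  by (intro var_codes_append[OF assms(1)]) auto

section \<open>Decoding\<close>

locale word_decoding =
  fixes \<alpha> :: "nat \<Rightarrow> 'a" and \<upsilon> :: 'a and k :: "nat \<Rightarrow> nat"
  assumes var: "i \<ge> 1 \<Longrightarrow> \<alpha> i \<noteq> \<upsilon>"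
    and k_pos: "n \<ge> 1 \<Longrightarrow> k n \<ge> 1" and k_mono: "mono_on {1..} k"
begin

definition letter :: "nat \<Rightarrow> 'a" where
  "letter c = (if c = 0 then \<upsilon> else \<alpha> c)"

definition place :: "nat \<Rightarrow> nat list \<Rightarrow> 'a list" where
  "place n x = replicate n (\<alpha> 1) @ map letter x"

text \<open>When a tuple is built from consecutive blocks starting at the first word, the padding of
  each entry is the total code length of the earlier ones. The codes thus determine the tuple, and
  colourings of tuples of words become colourings of tuples of codes.\<close>

definition place_tuple :: "nat list list \<Rightarrow> 'a list list" where
  "place_tuple ys = map (\<lambda>i. place (length (concat (take i ys))) (ys ! i)) [0..<length ys]"

lemma letter_eq_var: "letter c = \<upsilon> \<longleftrightarrow> c = 0"
  using var[of c] by (auto simp: letter_def)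

lemma length_place [simp]: "length (place n x) = n + length x"
  by (simp add: place_def)

lemma k_le: "1 \<le> i \<Longrightarrow> i \<le> j \<Longrightarrow> k i \<le> k j"
  using k_mono by (simp add: mono_on_def)

lemma mono_k_Suc: "mono (\<lambda>n. k (Suc n))"
  by (rule monoI) (simp add: k_le)

end

section \<open>Coded words placed one after another\<close>

locale placed_sequence = word_decoding +
  fixes Y :: "nat \<Rightarrow> nat list"
  assumes Y: "Y n \<in> var_codes (\<lambda>n. k (Suc n)) 0"
begin

definition offset :: "nat \<Rightarrow> nat" where
  "offset n = (\<Sum>j<n. length (Y j))"

text \<open>Shifts from codes counted from 0 to words counted from 1.\<close>

definition W :: "nat \<Rightarrow> 'a list" where
  "W n = place (offset (n - 1)) (Y (n - 1))"

lemma offset_Suc [simp]: "offset (Suc n) = offset n + length (Y n)"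
  by (simp add: offset_def)

lemma offset_0 [simp]: "offset 0 = 0"
  by (simp add: offset_def)

lemma Y_pos: "0 < length (Y n)"
  using Y[of n] by (auto simp: var_codes_def)

lemma offset_ge: "n \<le> offset n"
proof (induction n)
  case (Suc n)
  then show ?case using Y_pos[of n] by (simp del: length_greater_0_conv)
qed simp

lemma offset_cat: "x \<le> y \<Longrightarrow> offset x + length (cat Y a x y) = offset y"
  by (induction rule: dec_induct) (simp_all add: cat_Suc)

lemma W_in_var_words: "W n \<in> var_words \<alpha> \<upsilon> k"
proof -
  let ?o = "offset (n - 1)" and ?y = "Y (n - 1)"
  have "W n ! i \<in> insert \<upsilon> (\<alpha> ` {1..k (i + 1)})" if i: "i < length (W n)" for i
  proof (cases "i < ?o")
    case True
    then show ?thesis using k_pos[of "i + 1"] by (auto simp: W_def place_def nth_append)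
  next
    case False
    with i have "i - ?o < length ?y" by (auto simp: W_def)
    then have "?y ! (i - ?o) \<le> k (Suc (i - ?o))"
      using Y[of "n - 1"] by (auto simp: var_codes_def)
    also have "\<dots> \<le> k (i + 1)" by (rule k_le) auto
    finally show ?thesis
      using i False by (auto simp: W_def place_def nth_append letter_def)
  qed
  moreover have "letter 0 \<in> letter ` set ?y"
    using Y[of "n - 1"] by (intro imageI) (simp add: var_codes_def)
  then have "\<upsilon> \<in> set (W n)" by (simp add: letter_def W_def place_def)
  ultimately show ?thesis by (auto simp: var_words_def)
qed

lemma W_in_var_word_seqs: "W \<in> var_word_seqs \<alpha> \<upsilon> k"
proof -
  have "before \<alpha> (W n) (W (n + 1))" if "n \<ge> 1" for n
  proof -
    from that obtain j where "n = Suc j" by (cases n) auto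
    then show ?thesis using Y_pos[of n]
      by (simp add: before_def W_def) (simp add: place_def nth_append)
  qed
  then show ?thesis by (simp add: var_word_seqs_def W_in_var_words)
qed

text \<open>The truncation in \<open>T\<close> never takes effect: the variable of
  \<open>W (Suc j)\<close> occurs only at positions \<open>i \<ge> offset j \<ge> j\<close>, where
  \<open>c \<le> k (Suc j) \<le> k (i + 1)\<close>.\<close>

lemma T_W:
  assumes "c \<le> k (Suc j)"
  shows "T \<alpha> \<upsilon> k c (W (Suc j)) = place (offset j) (subst c (Y j))"
proof (cases "c = 0")
  case True
  then show ?thesis by (simp add: T_def W_def)
next
  case False
  show ?thesis
  proof (rule nth_equalityI)
    show "length (T \<alpha> \<upsilon> k c (W (Suc j))) = length (place (offset j) (subst c (Y j)))"
      using False by (simp add: T_def W_def)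
    fix i assume "i < length (T \<alpha> \<upsilon> k c (W (Suc j)))"
    then have i: "i < offset j + length (Y j)" using False by (simp add: T_def W_def)
    show "T \<alpha> \<upsilon> k c (W (Suc j)) ! i = place (offset j) (subst c (Y j)) ! i"
    proof (cases "i < offset j")
      case True
      then show ?thesis using False i var[of 1]
        by (simp add: T_def W_def) (simp add: place_def nth_append)
    next
      case ge: False
      have "k (Suc j) \<le> k (i + 1)"
        by (rule k_le) (use offset_ge[of j] ge in auto)
      with assms have "c \<le> k (i + 1)" by simp
      then show ?thesis using False i ge
        by (simp add: T_def W_def)
           (auto simp: place_def nth_append letter_eq_var subst_def, simp add: letter_def)
    qed
  qed
qed

text \<open>The first placed word has length \<open>offset (Suc x)\<close>, which is exactly the
  padding of the remaining block, so \<open>star\<close> drops that padding and concatenates the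
  codes.\<close>

lemma block_W:
  assumes "x < y" "\<And>j. x < j \<Longrightarrow> j \<le> y \<Longrightarrow> p j \<le> k j"
  shows "block \<alpha> \<upsilon> k W p x y = place (offset x) (cat Y (\<lambda>t. p (Suc t)) x y)"
  using assms
proof (induction "y - x" arbitrary: x)
  case (Suc n)
  have hd: "block \<alpha> \<upsilon> k W p x y = star (place (offset x) (subst (p (Suc x)) (Y x))) (block \<alpha> \<upsilon> k W p (Suc x) y)"
    using Suc.prems by (simp add: block_def upt_conv_Cons T_W del: upt_Suc)
  show ?case
  proof (cases "Suc x = y")
    case True
    then show ?thesis
      using hd by (simp add: block_def star_def cat_append_left)
  next
    case False
    then have "block \<alpha> \<upsilon> k W p (Suc x) y = place (offset (Suc x)) (cat Y (\<lambda>t. p (Suc t)) (Suc x) y)"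
      using Suc by simp
    then show ?thesis
      using Suc.prems(1) unfolding hd
      by (simp add: star_def cat_append_left) (simp add: place_def)
  qed
qed simp

lemma tuple_of_blocks:
  assumes l: "l 1 = 0" "strict_mono_on {1..m + 1} l"
    and p: "\<forall>j\<in>{1..l (m + 1)}. p j \<le> k j"
    and us: "length us = m" "\<And>i. i \<in> {1..m} \<Longrightarrow> us ! (i - 1) = block \<alpha> \<upsilon> k W p (l i) (l (i + 1))"
  shows "us = place_tuple (map (\<lambda>i. cat Y (\<lambda>t. p (Suc t)) (l (Suc i)) (l (Suc (Suc i)))) [0..<m])"
    (is "_ = place_tuple ?ys")
proof -
  have l_less: "l (Suc i) < l (Suc (Suc i))" if "i < m" for i
    using l(2) that by (auto simp: strict_mono_on_def)
  have l_le: "l (Suc i) \<le> l (m + 1)" if "i \<le> m" for i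
    using l(2) that by (cases "i = m") (auto simp: strict_mono_on_def less_imp_le)
  \<comment> \<open>The code lengths telescope because \<open>l 1 = 0\<close> and consecutive blocks
    are adjacent.\<close>
  have len: "length (concat (take i ?ys)) = offset (l (Suc i))" if "i \<le> m" for i
    using that
  proof (induction i)
    case 0
    then show ?case using l(1) by simp
  next
    case (Suc i)
    then show ?case
      using l_less[of i] offset_cat[of "l (Suc i)" "l (Suc (Suc i))"]
      by (simp add: take_Suc_conv_app_nth less_imp_le)
  qed
  have "us ! i = place (offset (l (Suc i))) (?ys ! i)" if "i < m" for i
  proof -
    have "us ! i = block \<alpha> \<upsilon> k W p (l (Suc i)) (l (Suc (Suc i)))"
      using us(2)[of "Suc i"] that by simp
    also have "\<dots> = place (offset (l (Suc i))) (?ys ! i)"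
      using that l_less[of i] p l_le[of "Suc i"] by (subst block_W) auto
    finally show ?thesis .
  qed
  then show ?thesis
    using us(1) len by (intro nth_equalityI) (auto simp: place_tuple_def )
qed

end

text \<open>The classes may overlap, so one index is chosen. The default 1 makes the colouring
  total, since arbitrary tuples of codes need not decode to tuples of dominated words.\<close>

definition colour_index :: "nat \<Rightarrow> (nat \<Rightarrow> 'b set) \<Rightarrow> 'b \<Rightarrow> nat" where
  "colour_index r A x = (if \<exists>i\<in>{1..r}. x \<in> A i then SOME i. i \<in> {1..r} \<and> x \<in> A i else 1)"

lemma colour_index_range: "1 \<le> r \<Longrightarrow> colour_index r A x \<in> {1..r}"
  and colour_index_mem: "x \<in> (\<Union>i\<in>{1..r}. A i) \<Longrightarrow> x \<in> A (colour_index r A x)"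
proof -
  have *: "colour_index r A x \<in> {1..r} \<and> x \<in> A (colour_index r A x)" if "\<exists>i\<in>{1..r}. x \<in> A i"
  proof -
    have "\<exists>i. i \<in> {1..r} \<and> x \<in> A i" using that by blast
    from someI_ex[OF this] show ?thesis using that by (simp add: colour_index_def)
  qed
  show "1 \<le> r \<Longrightarrow> colour_index r A x \<in> {1..r}"
    using * by (cases "\<exists>i\<in>{1..r}. x \<in> A i") (auto simp: colour_index_def)
  show "x \<in> (\<Union>i\<in>{1..r}. A i) \<Longrightarrow> x \<in> A (colour_index r A x)"
    using * by blast
qed

theorem theorem2p13:
  fixes m r s :: nat
    and \<Sigma> :: "'a set" and \<alpha> :: "nat \<Rightarrow> 'a" and \<upsilon> :: 'a
    and k :: "nat \<Rightarrow> nat"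
    and A C :: "nat \<Rightarrow> 'a list list set"
  assumes "m \<ge> 1" and "r \<ge> 1" and "s \<ge> 1"
    and "bij_betw \<alpha> {1..} \<Sigma>" and "\<upsilon> \<notin> \<Sigma>"
    and "\<forall>n\<ge>1. k n \<ge> 1" and "mono_on {1..} k"
    and "var_word_tuples \<alpha> \<upsilon> k m = (\<Union>i\<in>{1..r}. A i)"
    and "word_tuples \<alpha> k m = (\<Union>j\<in>{1..s}. C j)"
  shows "\<exists>w\<in>var_word_seqs \<alpha> \<upsilon> k. \<exists>i\<^sub>0\<in>{1..r}. \<exists>j\<^sub>0\<in>{1..s}.
           RV \<alpha> \<upsilon> k m w \<subseteq> A i\<^sub>0 \<and> R \<alpha> \<upsilon> k m w \<subseteq> C j\<^sub>0"
proof -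
  define \<kappa> where "\<kappa> n = k (Suc n)" for n
  interpret word_decoding \<alpha> \<upsilon> k
  proof
    show "\<alpha> i \<noteq> \<upsilon>" if "i \<ge> 1" for i
      using bij_betwE[OF assms(4)] assms(5) that by auto
  qed (use assms(6,7) in simp_all)
  have \<kappa>: "mono \<kappa>" "1 \<le> \<kappa> n" for n
    using mono_k_Suc k_pos[of "Suc n"] by (simp_all add: \<kappa>_def[abs_def])
  \<comment> \<open>One colouring of codes carries both: the second component colours the constant
    tuple obtained by putting the letter 1 for every variable.\<close>
  define c where "c ys = (colour_index r A (place_tuple ys), colour_index s C (place_tuple (map (subst 1) ys)))"
    for ys
  have c_range: "range c \<subseteq> {1..r} \<times> {1..s}"
    unfolding c_def by (intro image_subsetI SigmaI colour_index_range assms(2,3))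
  then have "finite (range c)" by (rule finite_subset) simp
  show ?thesis
  proof (rule monochromatic_var_code_sequence[OF \<kappa> \<open>finite (range c)\<close> assms(1)])
    fix X d
    assume d: "d \<in> range c" and X: "\<And>n. X n \<in> var_codes \<kappa> 0"
      and mono: "\<And>l a. l 0 = 0 \<Longrightarrow> (\<And>i. i < m \<Longrightarrow> l i < l (Suc i)) \<Longrightarrow> (\<And>t. t < l m \<Longrightarrow> a t \<le> \<kappa> t) \<Longrightarrow>
        (\<And>i. i < m \<Longrightarrow> 0 \<in> a ` {l i..<l (Suc i)}) \<Longrightarrow>
        c (map (\<lambda>i. cat X a (l i) (l (Suc i))) [0..<m]) = d"
    interpret placed_sequence \<alpha> \<upsilon> k "pair_up X"
      by unfold_locales (use pair_up_var_codes[OF \<kappa> X] in \<open>simp add: \<kappa>_def[abs_def]\<close>)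
    \<comment> \<open>Pairing moves the exponent of pair \<open>u\<close> to index
      \<open>2 * u\<close>, where monotonicity of \<open>\<kappa>\<close> still allows it; odd
      indices carry at most 1.\<close>
    have halves: "b t \<le> \<kappa> t" if "t < 2 * n" "\<And>t. t < n \<Longrightarrow> b (2 * t) \<le> \<kappa> t" "odd t \<Longrightarrow> b t \<le> 1" for b n t
    proof (cases "even t")
      case True
      then obtain u where u: "t = 2 * u" ..
      then have "b t \<le> \<kappa> u" using that(1,2) by simp
      also have "\<dots> \<le> \<kappa> t" using u \<kappa>(1) by (simp add: monoD)
      finally show ?thesis .
    qed (use that(3) \<kappa>(2)[of t] in simp)
    have "RV \<alpha> \<upsilon> k m W \<subseteq> A (fst d)"
    proof
      fix us assume "us \<in> RV \<alpha> \<upsilon> k m W"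
      then obtain l p where us: "us \<in> var_word_tuples \<alpha> \<upsilon> k m"
        and l: "l 1 = 0" "strict_mono_on {1..m + 1} l"
        and p: "\<forall>j\<in>{1..l (m + 1)}. p j \<le> k j"
        and bl: "\<And>i. i \<in> {1..m} \<Longrightarrow> us ! (i - 1) = block \<alpha> \<upsilon> k W p (l i) (l (i + 1))"
        and z: "\<And>i. i \<in> {1..m} \<Longrightarrow> 0 \<in> p ` {l i + 1..l (i + 1)}"
        unfolding RV_def by blast
      have l_less: "l (Suc i) < l (Suc (Suc i))" if "i < m" for i
        using l(2) that by (auto simp: strict_mono_on_def)
      \<comment> \<open>The second half of each pair gets the letter 1, as built into
        \<open>pair_up\<close>.\<close>
      define b where "b t = (if even t then p (Suc (t div 2)) else 1)" for t
      define ys where "ys = map (\<lambda>i. cat X b (2 * l (Suc i)) (2 * l (Suc (Suc i)))) [0..<m]"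
      have "length us = m" using us by (simp add: var_word_tuples_def)
      from tuple_of_blocks[OF l p this bl]
      have "us = place_tuple (map (\<lambda>i. cat (pair_up X) (\<lambda>t. p (Suc t)) (l (Suc i)) (l (Suc (Suc i)))) [0..<m])" .
      also have "map (\<lambda>i. cat (pair_up X) (\<lambda>t. p (Suc t)) (l (Suc i)) (l (Suc (Suc i)))) [0..<m] = ys"
        unfolding ys_def b_def
        by (intro map_cong refl cat_pair_up_var) (use l_less in \<open>simp add: less_imp_le\<close>)
      finally have "us = place_tuple ys" .
      moreover have "c ys = d"
        unfolding ys_def
      proof (rule mono[where l = "\<lambda>i. 2 * l (Suc i)"])
        show "b t \<le> \<kappa> t" if "t < 2 * l (Suc m)" for t
          by (rule halves[OF that]) (use p in \<open>auto simp: b_def \<kappa>_def\<close>)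
        \<comment> \<open>A zero of \<open>p\<close> at \<open>j\<close> is a zero of
          \<open>b\<close> at \<open>2 * (j - 1)\<close>, the shift being due to counting from
          0.\<close>
        show "0 \<in> b ` {2 * l (Suc i)..<2 * l (Suc (Suc i))}" if i: "i < m" for i
        proof -
          obtain j where j: "p j = 0" "l (Suc i) < j" "j \<le> l (Suc (Suc i))"
            using z[of "Suc i"] i by auto
          then show ?thesis
            by (intro image_eqI[of _ _ "2 * (j - 1)"]) (auto simp: b_def)
        qed
      qed (use l l_less in auto)
      ultimately have "colour_index r A us = fst d" by (auto simp: c_def)
      then show "us \<in> A (fst d)" using colour_index_mem[of us A r] us assms(8) by simp
    qed
    moreover have "R \<alpha> \<upsilon> k m W \<subseteq> C (snd d)"
    proof
      fix us assume "us \<in> R \<alpha> \<upsilon> k m W"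
      then obtain l p where us: "us \<in> word_tuples \<alpha> k m"
        and l: "l 1 = 0" "strict_mono_on {1..m + 1} l"
        and p: "\<forall>j\<in>{1..l (m + 1)}. 1 \<le> p j \<and> p j \<le> k j"
        and bl: "\<And>i. i \<in> {1..m} \<Longrightarrow> us ! (i - 1) = block \<alpha> \<upsilon> k W p (l i) (l (i + 1))"
        unfolding R_def by blast
      have l_less: "l (Suc i) < l (Suc (Suc i))" if "i < m" for i
        using l(2) that by (auto simp: strict_mono_on_def)
      have l_le: "l (Suc i) \<le> l (Suc m)" if "i \<le> m" for i
        using l(2) that by (cases "i = m") (auto simp: strict_mono_on_def less_imp_le)
      \<comment> \<open>The second half of each pair now keeps its variable, so that
        \<open>ys\<close> consists of variable words; \<open>subst 1\<close> recovers the constant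
        tuple.\<close>
      define b where "b t = (if even t then p (Suc (t div 2)) else 0)" for t
      define ys where "ys = map (\<lambda>i. cat X b (2 * l (Suc i)) (2 * l (Suc (Suc i)))) [0..<m]"
      have "length us = m" using us by (simp add: word_tuples_def)
      have "\<forall>j\<in>{1..l (m + 1)}. p j \<le> k j" using p by blast
      from tuple_of_blocks[OF l this \<open>length us = m\<close> bl]
      have "us = place_tuple (map (\<lambda>i. cat (pair_up X) (\<lambda>t. p (Suc t)) (l (Suc i)) (l (Suc (Suc i)))) [0..<m])" .
      also have "map (\<lambda>i. cat (pair_up X) (\<lambda>t. p (Suc t)) (l (Suc i)) (l (Suc (Suc i)))) [0..<m] =
          map (subst 1) ys"
        unfolding ys_def b_def map_map comp_def
      proof (intro map_cong refl cat_pair_up_const)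
        fix i t assume "i \<in> set [0..<m]" "l (Suc i) \<le> t" "t < l (Suc (Suc i))"
        then show "1 \<le> p (Suc t)" using p l_le[of "Suc i"] by simp
      qed (use l_less in \<open>simp add: less_imp_le\<close>)
      finally have "us = place_tuple (map (subst 1) ys)" .
      moreover have "c ys = d"
        unfolding ys_def
      proof (rule mono[where l = "\<lambda>i. 2 * l (Suc i)"])
        show "b t \<le> \<kappa> t" if "t < 2 * l (Suc m)" for t
          by (rule halves[OF that]) (use p in \<open>auto simp: b_def \<kappa>_def\<close>)
        \<comment> \<open>Each doubled interval contains an odd index because \<open>l\<close> is
          strictly increasing.\<close>
        show "0 \<in> b ` {2 * l (Suc i)..<2 * l (Suc (Suc i))}" if "i < m" for i
          using l_less[OF that] by (intro image_eqI[of _ _ "Suc (2 * l (Suc i))"]) (auto simp: b_def)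
      qed (use l l_less in auto)
      ultimately have "colour_index s C us = snd d" by (auto simp: c_def)
      then show "us \<in> C (snd d)" using colour_index_mem[of us C s] us assms(9) by simp
    qed
    moreover have "fst d \<in> {1..r}" "snd d \<in> {1..s}"
      using d c_range by auto
    ultimately show ?thesis using W_in_var_word_seqs by blast
  qed
qed

end
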